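(* Let $H$ be a real Hilbert space, $K\ge 2$, and let $D_1,\dots,D_K\subset S(H)$ be dictionaries satisfying the standing assumptions stated in the context. Let $i(n)\in\{1,\dots,K\}$, $n=1,2,\dots$, be a sequence containing each $k\in\{1,\dots,K\}$ infinitely often and such that $i(n)\ne i(n+1)$ for all $n$. Let $x_0\in H$, let $x_n=G_{i(n)}x_{n-1}$ for $n\ge 1$, and let $W$ be the set of all partial weak limits of $\{x_n\}$. If $W\ne\{0\}$, then there exist two different elements $w,w'\in W$ and indices $n_1<m_1<n_2<m_2<\dots$ such that $x_{n_k}\rightharpoonup w$ and $x_{m_k}\rightharpoonup w'$ weakly as $k\to\infty$, and $i(n)\in J(w)\cap J(w')$ for every integer $n\in\bigcup_k (n_k,m_k)$. Consequently, for these $w,w'$: (i) $\langle w'-w,a\rangle\ge 0$ for every $a\in A_{J(w)}$; (ii) $\langle w'-w,b\rangle\ge 0$ for every $b\in A_{J(w')}$.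
   Context: $\langle\cdot,\cdot\rangle$ and $|\cdot|$ denote the scalar product and the norm of $H$; $S(H)$ is the unit sphere of $H$. Standing assumptions on the dictionaries $D_1,\dots,D_K\subset S(H)$: (a) the union $\bigcup_{i=1}^K D_i$ is contained in no half-space, i.e. for any nonzero $v\in H$ there is $g\in\bigcup_{i=1}^K D_i$ with $\langle v,g\rangle>0$; (b) for each $x\in H$ and each $i\in\{1,\dots,K\}$, if $\sup_{g\in D_i}\langle x,g\rangle>0$, then this supremum is attained at some element of $D_i$. For $x\in H$: if $\sup_{g\in D_i}\langle x,g\rangle>0$, then $g_i(x)$ denotes an element of $D_i$ at which the supremum is attained (any one of them if there are several); if $\sup_{g\in D_i}\langle x,g\rangle\le 0$, then $g_i(x)=0$. The greedy step with respect to $D_i$ is $G_i(x)=x-\langle x,g_i(x)\rangle g_i(x)$. A partial weak limit of $\{x_n\}$ is the weak limit of some subsequence of $\{x_n\}$. Define the closed convex cones $A_i=\{y\in H:\langle y,g\rangle\le 0\text{ for all }g\in D_i\}$, $i=1,\dots,K$, and $A_J=\bigcap_{j\in J}A_j$ for $J\subset\{1,\dots,K\}$. For $w\in W$, $J(w)$ is the maximal subset of $\{1,\dots,K\}$ such that $w\in A_{J(w)}$, i.e. $J(w)=\{j: w\in A_j\}$. $(n_k,m_k)$ denotes the open interval. *)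

theory Defs
  imports "HOL-Analysis.Analysis"
begin

definition weakly_tendsto :: "(nat \<Rightarrow> 'a::real_inner) \<Rightarrow> 'a \<Rightarrow> bool" where
  "weakly_tendsto x l \<longleftrightarrow> (\<forall>y. (\<lambda>n. x n \<bullet> y) \<longlonglongrightarrow> l \<bullet> y)"

definition partial_weak_limits :: "(nat \<Rightarrow> 'a::real_inner) \<Rightarrow> 'a set" where
  "partial_weak_limits x = {w. \<exists>r. strict_mono r \<and> weakly_tendsto (x \<circ> r) w}"

(* The supremum is taken in the extended reals, so that it is -\<infinity> when D is empty. *)
definition dict_sup :: "'a::real_inner set \<Rightarrow> 'a \<Rightarrow> ereal" where
  "dict_sup D x = (SUP g\<in>D. ereal (x \<bullet> g))"

definition not_in_half_space :: "'a::real_inner set \<Rightarrow> bool" where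
  "not_in_half_space D \<longleftrightarrow> (\<forall>v. v \<noteq> 0 \<longrightarrow> (\<exists>g\<in>D. v \<bullet> g > 0))"

definition sup_attained :: "'a::real_inner set \<Rightarrow> bool" where
  "sup_attained D \<longleftrightarrow>
    (\<forall>x. dict_sup D x > 0 \<longrightarrow> (\<exists>g\<in>D. ereal (x \<bullet> g) = dict_sup D x))"

(* \<gamma> is one admissible choice x \<mapsto> g(x) for the dictionary D; ties between
   maximizers may be broken arbitrarily. *)
definition greedy_selection :: "'a::real_inner set \<Rightarrow> ('a \<Rightarrow> 'a) \<Rightarrow> bool" where
  "greedy_selection D \<gamma> \<longleftrightarrow>
    (\<forall>x. if dict_sup D x > 0 then \<gamma> x \<in> D \<and> ereal (x \<bullet> \<gamma> x) = dict_sup D x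
         else \<gamma> x = 0)"

definition greedy_step :: "('a::real_inner \<Rightarrow> 'a) \<Rightarrow> 'a \<Rightarrow> 'a" where
  "greedy_step \<gamma> x = x - (x \<bullet> \<gamma> x) *\<^sub>R \<gamma> x"

definition dict_cone :: "'a::real_inner set \<Rightarrow> 'a set" where
  "dict_cone D = {y. \<forall>g\<in>D. y \<bullet> g \<le> 0}"

definition cone_Inter :: "(nat \<Rightarrow> 'a::real_inner set) \<Rightarrow> nat set \<Rightarrow> 'a set" where
  "cone_Inter D J = (\<Inter>j\<in>J. dict_cone (D j))"

(* The largest J \<subseteq> {1..K} with w \<in> cone_Inter D J. *)
definition max_index_set :: "nat \<Rightarrow> (nat \<Rightarrow> 'a::real_inner set) \<Rightarrow> 'a \<Rightarrow> nat set" where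
  "max_index_set K D w = {j\<in>{1..K}. w \<in> dict_cone (D j)}"

end

theory Submission
  imports Defs "HOL-Complex_Analysis.Great_Picard"
begin

text \<open>
  Each greedy step decreases the squared norm by the square of its length, so the orbit \<open>x\<close> is
  bounded and its steps tend to zero. Hence a weak limit taken along infinitely many steps with the
  same label \<open>j\<close> lies in the polar cone of \<open>D j\<close>, that is, \<open>j\<close> belongs to its label set
  (\<open>frequent_index_in_max_index_set\<close>). A nonzero weak limit misses some label, because the dictionaries
  lie in no half-space, while every label recurs; together with weak sequential compactness of
  bounded sets (\<open>bounded_imp_weakly_convergent_subseq\<close>) this produces a second weak limit, and the
  orbit oscillates between the two.

  Among all such oscillations take one that uses a minimal set \<open>T\<close> of labels strictly between the
  times near \<open>w\<close> and the times near \<open>w'\<close>. If some \<open>j \<in> T\<close> were missing from the label set of \<open>w\<close>, one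
  could stop each interval at the first occurrence of \<open>j\<close>: the weak limits there contain \<open>j\<close> in their
  label set, so they differ from \<open>w\<close>, and the shortened oscillation avoids \<open>j\<close>. Dually, a label missing from
  that of \<open>w'\<close> is removed by starting at its last occurrence. So minimality forces \<open>T\<close> into both label sets
  (\<open>oscillates_within_common_labels\<close>).

  The inequalities follow because a step with label \<open>j\<close> subtracts a nonnegative multiple of an element
  of \<open>D j\<close>, so it does not decrease the inner product with a vector of the polar cone of \<open>D j\<close>
  (\<open>oscillates_inner_mono\<close>).
\<close>

section \<open>Weak convergence in a Hilbert space\<close>

lemma weakly_tendsto_subseq:
  assumes "weakly_tendsto u w" "strict_mono r"
  shows "weakly_tendsto (u \<circ> r) w"
  unfolding weakly_tendsto_def
proof
  fix y
  have "(\<lambda>n. u n \<bullet> y) \<longlonglongrightarrow> w \<bullet> y"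
    using assms(1) by (simp add: weakly_tendsto_def)
  from LIMSEQ_subseq_LIMSEQ[OF this assms(2)] show "(\<lambda>n. (u \<circ> r) n \<bullet> y) \<longlonglongrightarrow> w \<bullet> y"
    by (simp add: o_def)
qed

lemma weakly_tendsto_eq_if_frequently_eq:
  assumes "weakly_tendsto u w" "weakly_tendsto v w'" "\<exists>\<^sub>F k in sequentially. u k = v k"
  shows "w = w'"
proof (rule ccontr)
  assume "w \<noteq> w'"
  have "(\<lambda>k. u k \<bullet> (w - w') - v k \<bullet> (w - w')) \<longlonglongrightarrow> w \<bullet> (w - w') - w' \<bullet> (w - w')"
    using assms(1,2) unfolding weakly_tendsto_def by (intro tendsto_diff) auto
  then have lim: "(\<lambda>k. u k \<bullet> (w - w') - v k \<bullet> (w - w')) \<longlonglongrightarrow> (w - w') \<bullet> (w - w')"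
    by (simp add: inner_diff_left)
  have "\<forall>\<^sub>F k in sequentially. u k \<bullet> (w - w') - v k \<bullet> (w - w') \<noteq> 0"
    using tendsto_imp_eventually_ne[OF lim, of 0] \<open>w \<noteq> w'\<close> by simp
  with assms(3) have "\<exists>\<^sub>F k in sequentially. u k = v k \<and> u k \<bullet> (w - w') - v k \<bullet> (w - w') \<noteq> 0"
    by (rule frequently_eventually_frequently)
  then show False
    by (auto dest: frequently_ex)
qed

text \<open>
  In place of a weak cluster point, take convex combinations of the tails whose norm is almost
  minimal. By the parallelogram law they form a norm Cauchy sequence, and since they are convex
  combinations of late terms, their limit sees every functional that converges along the
  sequence. This avoids duality and the Riesz representation.
\<close>

lemma limit_of_tail_convex_combinations:
  fixes u :: "nat \<Rightarrow> 'a::{real_inner, complete_space}"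
  assumes bdd: "bounded (range u)"
  obtains z where "z \<in> closure (convex hull range u)"
    and "\<And>y L. (\<lambda>n. u n \<bullet> y) \<longlonglongrightarrow> L \<Longrightarrow> z \<bullet> y = L"
proof -
  define C where "C k = convex hull (u ` {k..})" for k
  define d where "d k = (INF v\<in>C k. norm v)" for k
  obtain B where B: "\<And>n. norm (u n) \<le> B"
    using bdd by (auto simp: bounded_iff)
  have uC: "u k \<in> C k" for k
    unfolding C_def by (rule hull_inc) auto
  have C_mono: "C l \<subseteq> C k" if "k \<le> l" for k l
    unfolding C_def using that by (intro hull_mono) auto
  have bdd_below: "bdd_below (norm ` C k)" for k
    by (rule bdd_belowI[of _ 0]) auto
  have d_le: "d k \<le> norm v" if "v \<in> C k" for k v
    unfolding d_def using bdd_below that by (rule cINF_lower)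
  have d_nonneg: "0 \<le> d k" for k
    unfolding d_def using uC by (intro cINF_greatest) auto
  have "mono d"
  proof (rule monoI)
    fix k l :: nat
    assume "k \<le> l"
    then show "d k \<le> d l"
      unfolding d_def[of l] using uC[of l] C_mono d_le by (intro cINF_greatest) blast+
  qed
  have d_B: "d k \<le> B" for k
    using d_le[OF uC] B order_trans by blast
  have "\<exists>v\<in>C k. norm v < d k + 1 / real (Suc k)" for k
    using cINF_less_iff[OF _ bdd_below, of k "d k + 1 / real (Suc k)"] uC[of k]
    by (auto simp: d_def)
  then obtain z where zC: "\<And>k. z k \<in> C k" and z_lt: "\<And>k. norm (z k) < d k + 1 / real (Suc k)"
    by metis
  obtain d' where d': "d \<longlonglongrightarrow> d'" and d_le': "\<And>k. d k \<le> d'"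
    using incseq_convergent[of d B] \<open>mono d\<close> d_B by blast
  \<comment> \<open>The parallelogram law bounds \<open>norm (z k - z l)\<close> through this excess over the minimal norm.\<close>
  define \<epsilon> where "\<epsilon> k = 4 * ((d' + 1 / real (Suc k))\<^sup>2 - (d k)\<^sup>2)" for k
  have "\<epsilon> \<longlonglongrightarrow> 4 * ((d' + 0)\<^sup>2 - d'\<^sup>2)"
    unfolding \<epsilon>_def by (intro tendsto_intros d' LIMSEQ_Suc[OF lim_1_over_n])
  then have \<epsilon>: "\<epsilon> \<longlonglongrightarrow> 0"
    by simp
  have close: "(norm (z k - z l))\<^sup>2 \<le> \<epsilon> k" if "k \<le> l" for k l
  proof -
    have "(1/2) *\<^sub>R z k + (1/2) *\<^sub>R z l \<in> C k"
      using zC C_mono[OF that] convex_convex_hull[of "u ` {k..}"]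
      unfolding C_def[of k] by (intro convexD) (auto simp: C_def)
    then have "d k \<le> norm ((1/2) *\<^sub>R (z k + z l))"
      using d_le by (simp add: scaleR_add_right)
    then have "2 * d k \<le> norm (z k + z l)"
      by simp
    then have mid: "4 * (d k)\<^sup>2 \<le> (norm (z k + z l))\<^sup>2"
      using power_mono[of "2 * d k" "norm (z k + z l)" 2] d_nonneg[of k]
      by (simp add: power_mult_distrib)
    have "norm (z k) \<le> d' + 1 / real (Suc k)"
      using z_lt[of k] d_le'[of k] by linarith
    then have zk: "(norm (z k))\<^sup>2 \<le> (d' + 1 / real (Suc k))\<^sup>2"
      by (simp add: power_mono)
    have "1 / real (Suc l) \<le> 1 / real (Suc k)"
      using that by (simp add: frac_le)
    then have "norm (z l) \<le> d' + 1 / real (Suc k)"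
      using z_lt[of l] d_le'[of l] by linarith
    then have zl: "(norm (z l))\<^sup>2 \<le> (d' + 1 / real (Suc k))\<^sup>2"
      by (simp add: power_mono)
    have "(norm (z k - z l))\<^sup>2 + (norm (z k + z l))\<^sup>2 = 2 * (norm (z k))\<^sup>2 + 2 * (norm (z l))\<^sup>2"
      by (simp add: power2_norm_eq_inner inner_simps inner_commute)
    moreover have "\<epsilon> k = 4 * (d' + 1 / real (Suc k))\<^sup>2 - 4 * (d k)\<^sup>2"
      unfolding \<epsilon>_def by (rule right_diff_distrib)
    ultimately show ?thesis
      using mid zk zl by linarith
  qed
  have "Cauchy z"
  proof (rule CauchyI')
    fix e :: real
    assume "0 < e"
    then have "0 < e\<^sup>2"
      by simp
    with \<epsilon> have "\<forall>\<^sub>F k in sequentially. \<epsilon> k < e\<^sup>2"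
      by (rule order_tendstoD(2))
    then obtain M where M: "\<And>k. k \<ge> M \<Longrightarrow> \<epsilon> k < e\<^sup>2"
      unfolding eventually_sequentially by blast
    have "dist (z k) (z l) < e" if "k \<ge> M" "l > k" for k l
    proof -
      have "(norm (z k - z l))\<^sup>2 < e\<^sup>2"
        using close[of k l] M[of k] that by linarith
      then show ?thesis
        using \<open>0 < e\<close> by (simp add: dist_norm power2_less_imp_less)
    qed
    then show "\<exists>M. \<forall>m\<ge>M. \<forall>n>m. dist (z m) (z n) < e"
      by blast
  qed
  then obtain z' where z': "z \<longlonglongrightarrow> z'"
    by (metis Cauchy_convergent convergent_def)
  show thesis
  proof
    have "z k \<in> convex hull range u" for k
      using zC[of k] C_mono[of 0 k] by (auto simp: C_def atLeast_0)
    with z' show "z' \<in> closure (convex hull range u)"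
      unfolding closure_sequential by blast
  next
    fix y L
    assume L: "(\<lambda>n. u n \<bullet> y) \<longlonglongrightarrow> L"
    have "(\<lambda>k. z k \<bullet> y) \<longlonglongrightarrow> L"
    proof (rule LIMSEQ_I)
      fix e :: real
      assume "0 < e"
      then have "0 < e / 2"
        by simp
      then obtain N where N: "\<And>n. n \<ge> N \<Longrightarrow> norm (u n \<bullet> y - L) < e / 2"
        using LIMSEQ_D[OF L] by blast
      define T where "T = {v. y \<bullet> v \<le> L + e / 2} \<inter> {v. y \<bullet> v \<ge> L - e / 2}"
      have "convex T"
        unfolding T_def by (intro convex_Int convex_halfspace_le convex_halfspace_ge)
      have "u n \<in> T" if "n \<ge> N" for n
        using N[OF that] unfolding T_def inner_commute[of y] real_norm_def abs_less_iff
        by (simp; linarith)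
      then have "C N \<subseteq> T"
        unfolding C_def using \<open>convex T\<close> by (intro hull_minimal) auto
      have "norm (z k \<bullet> y - L) < e" if "k \<ge> N" for k
      proof -
        have "z k \<in> T"
          using zC[of k] C_mono[OF that] \<open>C N \<subseteq> T\<close> by blast
        then show ?thesis
          using \<open>0 < e\<close> by (simp add: T_def inner_commute abs_less_iff)
      qed
      then show "\<exists>N. \<forall>k\<ge>N. norm (z k \<bullet> y - L) < e"
        by blast
    qed
    moreover have "(\<lambda>k. z k \<bullet> y) \<longlonglongrightarrow> z' \<bullet> y"
      by (intro tendsto_intros z')
    ultimately show "z' \<bullet> y = L"
      using LIMSEQ_unique by blast
  qed
qed

text \<open>
  After a diagonal extraction the inner products with all terms of the sequence converge.
  The vector from the previous lemma is then the weak limit: two such vectors, obtained from two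
  subsequences, have the same inner products with all terms and lie in the closed linear span of
  the terms, so they coincide, and hence no functional can have a second cluster value.
\<close>

lemma bounded_imp_weakly_convergent_subseq:
  fixes u :: "nat \<Rightarrow> 'a::{real_inner, complete_space}"
  assumes bdd: "bounded (range u)"
  obtains r w where "strict_mono (r :: nat \<Rightarrow> nat)" "weakly_tendsto (u \<circ> r) w"
proof -
  obtain B where B: "\<And>n. norm (u n) \<le> B"
    using bdd by (auto simp: bounded_iff)
  have "norm (u n \<bullet> u j) \<le> B * B" for n j
  proof -
    have "0 \<le> B"
      using B[of 0] norm_ge_zero order_trans by blast
    then have "norm (u n) * norm (u j) \<le> B * B"
      using B by (intro mult_mono) auto
    then show ?thesis
      using Cauchy_Schwarz_ineq2[of "u n" "u j"] by simp
  qed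
  then obtain r where r: "strict_mono r"
    and conv: "\<And>j. \<exists>l. (\<lambda>n. u (r n) \<bullet> u j) \<longlonglongrightarrow> l"
    using function_convergent_subsequence[of "UNIV :: nat set" "\<lambda>n j. u n \<bullet> u j" "B * B"]
    by (metis UNIV_I countableI_type)
  have bdd_sub: "bounded (range (u \<circ> s))" for s :: "nat \<Rightarrow> nat"
    using bdd by (rule bounded_subset) auto
  obtain w where w: "w \<in> closure (convex hull range (u \<circ> r))"
    and w_lim: "\<And>y L. (\<lambda>n. (u \<circ> r) n \<bullet> y) \<longlonglongrightarrow> L \<Longrightarrow> w \<bullet> y = L"
    using limit_of_tail_convex_combinations[OF bdd_sub] by metis
  have hull_sub: "closure (convex hull range (u \<circ> s)) \<subseteq> closure (convex hull range u)" for s :: "nat \<Rightarrow> nat"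
    by (intro closure_mono hull_mono) auto
  have sub_lim: "w \<bullet> y = L" if s: "strict_mono s" and L: "(\<lambda>n. u (r (s n)) \<bullet> y) \<longlonglongrightarrow> L" for s y L
  proof -
    obtain v where v: "v \<in> closure (convex hull range (u \<circ> (r \<circ> s)))"
      and v_lim: "\<And>y L. (\<lambda>n. (u \<circ> (r \<circ> s)) n \<bullet> y) \<longlonglongrightarrow> L \<Longrightarrow> v \<bullet> y = L"
      using limit_of_tail_convex_combinations[OF bdd_sub] by metis
    have "(w - v) \<bullet> u j = 0" for j
    proof -
      obtain l where l: "(\<lambda>n. u (r n) \<bullet> u j) \<longlonglongrightarrow> l"
        using conv by blast
      have "w \<bullet> u j = l" "v \<bullet> u j = l"
        using w_lim[of "u j" l] v_lim[of "u j" l] l LIMSEQ_subseq_LIMSEQ[OF l s]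
        by (auto simp: o_def)
      then show ?thesis
        by (simp add: inner_diff_left)
    qed
    then have "convex hull range u \<subseteq> {y. (w - v) \<bullet> y = 0}"
      by (intro hull_minimal convex_hyperplane) auto
    then have "closure (convex hull range u) \<subseteq> {y. (w - v) \<bullet> y = 0}"
      by (intro closure_minimal closed_hyperplane)
    then have "(w - v) \<bullet> w = 0" "(w - v) \<bullet> v = 0"
      using w v hull_sub by blast+
    then have "(w - v) \<bullet> (w - v) = 0"
      by (simp add: inner_diff_right)
    then have "w = v"
      by simp
    with v_lim[of y L] L show ?thesis
      by simp
  qed
  have "(\<lambda>n. u (r n) \<bullet> y) \<longlonglongrightarrow> w \<bullet> y" for y
  proof (rule ccontr)
    assume "\<not> (\<lambda>n. u (r n) \<bullet> y) \<longlonglongrightarrow> w \<bullet> y"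
    then obtain e where "0 < e" and far: "\<exists>\<^sub>\<infinity>n. e \<le> dist (u (r n) \<bullet> y) (w \<bullet> y)"
      unfolding tendsto_iff frequently_sequentially[symmetric] not_eventually[symmetric]
      by (auto simp: not_eventually not_less cofinite_eq_sequentially)
    then obtain s :: "nat \<Rightarrow> nat" where s: "strict_mono s"
      and s_far: "\<forall>n. s n \<in> {n. e \<le> dist (u (r n) \<bullet> y) (w \<bullet> y)}"
      using infinite_enumerate[OF far[unfolded INFM_iff_infinite]] by blast
    have "bounded (range (\<lambda>n. u (r (s n)) \<bullet> y))"
    proof (rule boundedI)
      fix v assume "v \<in> range (\<lambda>n. u (r (s n)) \<bullet> y)"
      then obtain n where v: "v = u (r (s n)) \<bullet> y"
        by blast
      show "norm v \<le> B * norm y"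
        using Cauchy_Schwarz_ineq2[of "u (r (s n))" y] mult_right_mono[OF B[of "r (s n)"], of "norm y"]
        by (simp add: v)
    qed
    then obtain L t where t: "strict_mono t" and L: "((\<lambda>n. u (r (s n)) \<bullet> y) \<circ> t) \<longlonglongrightarrow> L"
      using bounded_imp_convergent_subsequence by blast
    have "w \<bullet> y = L"
      using sub_lim[OF strict_mono_o[OF s t], of y L] L by (simp add: o_def)
    then have "\<forall>\<^sub>F n in sequentially. dist (u (r (s (t n))) \<bullet> y) (w \<bullet> y) < e"
      using L \<open>0 < e\<close> by (auto simp: tendsto_iff o_def)
    then obtain n where "dist (u (r (s (t n))) \<bullet> y) (w \<bullet> y) < e"
      by (auto simp: eventually_sequentially)
    moreover have "e \<le> dist (u (r (s (t n))) \<bullet> y) (w \<bullet> y)"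
      using s_far by blast
    ultimately show False
      by simp
  qed
  then have "weakly_tendsto (u \<circ> r) w"
    by (simp add: weakly_tendsto_def)
  with r show thesis
    by (rule that)
qed

section \<open>Oscillation between two weak limits\<close>

definition interlaced :: "(nat \<Rightarrow> nat) \<Rightarrow> (nat \<Rightarrow> nat) \<Rightarrow> bool" where
  "interlaced n m \<longleftrightarrow> (\<forall>k. n k < m k \<and> m k < n (Suc k))"

lemma interlacedD:
  assumes "interlaced n m"
  shows "n k < m k" "strict_mono n" "strict_mono m"
  using assms unfolding interlaced_def strict_mono_Suc_iff by (meson less_trans)+

lemma interlaced_subseq_between:
  assumes nm: "interlaced n m" and r: "strict_mono r"
    and sub: "\<And>k. n k \<le> p k" "\<And>k. p k < q k" "\<And>k. q k \<le> m k"
  shows "interlaced (p \<circ> r) (q \<circ> r)"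
proof -
  have "q (r k) < p (r (Suc k))" for k
  proof -
    have "Suc (r k) \<le> r (Suc k)"
      using r by (simp add: strict_mono_Suc_iff Suc_le_eq)
    then have "n (Suc (r k)) \<le> n (r (Suc k))"
      using interlacedD(2)[OF nm] strict_mono_less_eq by blast
    moreover have "m (r k) < n (Suc (r k))"
      using nm by (simp add: interlaced_def)
    ultimately show ?thesis
      using sub(3)[of "r k"] sub(1)[of "r (Suc k)"] by linarith
  qed
  with sub(2) show ?thesis
    by (simp add: interlaced_def)
qed

lemma strict_mono_imp_interlaced_subseqs:
  fixes r s :: "nat \<Rightarrow> nat"
  assumes r: "strict_mono r" and s: "strict_mono s"
  obtains a b where "strict_mono a" "strict_mono b" "interlaced (r \<circ> a) (s \<circ> b)"
proof -
  \<comment> \<open>A strictly increasing map satisfies \<open>k \<le> s k\<close>, so its value at a large index exceeds any given time.\<close>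
  define a where "a = rec_nat 0 (\<lambda>_ c. Suc (s (Suc (r c))))"
  define b where "b k = Suc (r (a k))" for k
  have a_Suc: "a (Suc k) = Suc (s (b k))" for k
    by (simp add: a_def b_def)
  have rb: "r (a k) < s (b k)" for k
    using seq_suble[OF s, of "b k"] by (simp add: b_def)
  have sa: "s (b k) < r (a (Suc k))" for k
    using seq_suble[OF r, of "a (Suc k)"] by (simp add: a_Suc)
  have "r (a k) < r (a (Suc k))" "s (b k) < s (b (Suc k))" for k
    using rb sa less_trans by blast+
  then have "a k < a (Suc k)" "b k < b (Suc k)" for k
    using strict_mono_less[OF r] strict_mono_less[OF s] by blast+
  then have "strict_mono a" "strict_mono b"
    by (simp_all add: strict_mono_Suc_iff)
  with rb sa show thesis
    using that by (simp add: interlaced_def)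
qed

text \<open>
  The labels at the end times themselves are left free, so that an interval cut at an occurrence
  of a label no longer counts that occurrence.
\<close>

definition oscillates ::
    "(nat \<Rightarrow> 'a::real_inner) \<Rightarrow> (nat \<Rightarrow> 'b) \<Rightarrow> 'b set \<Rightarrow> (nat \<Rightarrow> nat) \<Rightarrow> (nat \<Rightarrow> nat) \<Rightarrow> 'a \<Rightarrow> 'a \<Rightarrow> bool" where
  "oscillates x i T n m w w' \<longleftrightarrow>
    interlaced n m \<and> weakly_tendsto (x \<circ> n) w \<and> weakly_tendsto (x \<circ> m) w' \<and> w \<noteq> w' \<and>
    (\<forall>k. \<forall>l\<in>{n k<..<m k}. i l \<in> T)"

text \<open>
  Suppose a label \<open>j \<in> T\<close> is missing from \<open>J w\<close>. Cut each interval at the first occurrence of \<open>j\<close>,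
  or at its right end if \<open>j\<close> does not occur. A weak limit at the cutting points differs from \<open>w\<close>: either
  it is \<open>w'\<close>, or \<open>j\<close> belongs to its label set. So there is an oscillation that does not use \<open>j\<close>.
\<close>

lemma oscillates_drop_left_label:
  fixes x :: "nat \<Rightarrow> 'a::{real_inner, complete_space}" and i :: "nat \<Rightarrow> 'b"
  assumes bdd: "bounded (range x)"
    and hit: "\<And>p w j. strict_mono p \<Longrightarrow> weakly_tendsto (x \<circ> p) w \<Longrightarrow>
      \<exists>\<^sub>F k in sequentially. i (p k) = j \<Longrightarrow> j \<in> J w"
    and osc: "oscillates x i T n m w w'" and j: "j \<notin> J w"
  shows "\<exists>n m w w'. oscillates x i (T - {j}) n m w w'"
proof -
  have nm: "interlaced n m" and wn: "weakly_tendsto (x \<circ> n) w" and wm: "weakly_tendsto (x \<circ> m) w'"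
    and "w \<noteq> w'" and T: "\<And>k l. n k < l \<Longrightarrow> l < m k \<Longrightarrow> i l \<in> T"
    using osc by (auto simp: oscillates_def)
  define Q where "Q k l \<longleftrightarrow> n k < l \<and> (l = m k \<or> i l = j)" for k l
  define p where "p k = (LEAST l. Q k l)" for k
  have Qm: "Q k (m k)" for k
    using interlacedD(1)[OF nm] by (simp add: Q_def)
  have Qp: "Q k (p k)" for k
    unfolding p_def by (rule LeastI) (rule Qm)
  have pm: "p k \<le> m k" for k
    unfolding p_def by (rule Least_le) (rule Qm)
  have before: "\<not> Q k l" if "l < p k" for k l
    using that unfolding p_def by (rule not_less_Least)
  have np: "n k < p k" for k
    using Qp by (simp add: Q_def)
  have "bounded (range (x \<circ> p))"
    using bdd by (rule bounded_subset) auto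
  then obtain r v where r: "strict_mono r" and v: "weakly_tendsto ((x \<circ> p) \<circ> r) v"
    by (rule bounded_imp_weakly_convergent_subseq)
  have il: "interlaced (n \<circ> r) (p \<circ> r)"
    using interlaced_subseq_between[OF nm r, of n p] np pm by simp
  have wn': "weakly_tendsto (x \<circ> (n \<circ> r)) w" and wm': "weakly_tendsto (x \<circ> (m \<circ> r)) w'"
    using weakly_tendsto_subseq[OF wn r] weakly_tendsto_subseq[OF wm r] by (simp_all add: o_assoc)
  have v': "weakly_tendsto (x \<circ> (p \<circ> r)) v"
    using v by (simp add: o_assoc)
  have "\<exists>\<^sub>F k in sequentially. p (r k) = m (r k) \<or> i (p (r k)) = j"
    using Qp by (intro eventually_frequently always_eventually) (auto simp: Q_def)
  then consider "\<exists>\<^sub>F k in sequentially. p (r k) = m (r k)" | "\<exists>\<^sub>F k in sequentially. i (p (r k)) = j"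
    by (auto simp: frequently_disj_iff)
  then have "w \<noteq> v"
  proof cases
    case 1
    have "v = w'"
      by (rule weakly_tendsto_eq_if_frequently_eq[OF v' wm']) (rule frequently_elim1[OF 1], simp)
    with \<open>w \<noteq> w'\<close> show ?thesis
      by simp
  next
    case 2
    have "j \<in> J v"
      using hit[OF interlacedD(3)[OF il] v'] 2 by simp
    with j show ?thesis
      by blast
  qed
  have "i l \<in> T - {j}" if "n k < l" "l < p k" for k l
    using that T[of k l] pm[of k] before[of l k] by (auto simp: Q_def)
  then have "\<forall>k. \<forall>l\<in>{(n \<circ> r) k<..<(p \<circ> r) k}. i l \<in> T - {j}"
    by (metis comp_apply greaterThanLessThan_iff)
  with il wn' v' \<open>w \<noteq> v\<close> have "oscillates x i (T - {j}) (n \<circ> r) (p \<circ> r) w v"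
    unfolding oscillates_def by blast
  then show ?thesis
    by blast
qed

text \<open>The mirror image: cut after the last occurrence of \<open>j\<close>, or at the left end of the interval.\<close>

lemma oscillates_drop_right_label:
  fixes x :: "nat \<Rightarrow> 'a::{real_inner, complete_space}" and i :: "nat \<Rightarrow> 'b"
  assumes bdd: "bounded (range x)"
    and hit: "\<And>p w j. strict_mono p \<Longrightarrow> weakly_tendsto (x \<circ> p) w \<Longrightarrow>
      \<exists>\<^sub>F k in sequentially. i (p k) = j \<Longrightarrow> j \<in> J w"
    and osc: "oscillates x i T n m w w'" and j: "j \<notin> J w'"
  shows "\<exists>n m w w'. oscillates x i (T - {j}) n m w w'"
proof -
  have nm: "interlaced n m" and wn: "weakly_tendsto (x \<circ> n) w" and wm: "weakly_tendsto (x \<circ> m) w'"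
    and "w \<noteq> w'" and T: "\<And>k l. n k < l \<Longrightarrow> l < m k \<Longrightarrow> i l \<in> T"
    using osc by (auto simp: oscillates_def)
  define Q where "Q k l \<longleftrightarrow> n k \<le> l \<and> l < m k \<and> (l = n k \<or> i l = j)" for k l
  define p where "p k = (GREATEST l. Q k l)" for k
  have Qn: "Q k (n k)" for k
    using interlacedD(1)[OF nm] by (simp add: Q_def)
  have Q_bound: "\<forall>l. Q k l \<longrightarrow> l \<le> m k" for k
    by (simp add: Q_def)
  have Qp: "Q k (p k)" for k
    unfolding p_def by (rule GreatestI_nat[where b = "m k"]) (use Qn Q_bound in auto)
  have after: "l \<le> p k" if "Q k l" for k l
    unfolding p_def by (rule Greatest_le_nat[where b = "m k"]) (use that Q_bound in auto)
  have np: "n k \<le> p k" and pm: "p k < m k" for k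
    using Qp by (simp_all add: Q_def)
  have "bounded (range (x \<circ> p))"
    using bdd by (rule bounded_subset) auto
  then obtain r v where r: "strict_mono r" and v: "weakly_tendsto ((x \<circ> p) \<circ> r) v"
    by (rule bounded_imp_weakly_convergent_subseq)
  have il: "interlaced (p \<circ> r) (m \<circ> r)"
    using interlaced_subseq_between[OF nm r, of p m] np pm by simp
  have wn': "weakly_tendsto (x \<circ> (n \<circ> r)) w" and wm': "weakly_tendsto (x \<circ> (m \<circ> r)) w'"
    using weakly_tendsto_subseq[OF wn r] weakly_tendsto_subseq[OF wm r] by (simp_all add: o_assoc)
  have v': "weakly_tendsto (x \<circ> (p \<circ> r)) v"
    using v by (simp add: o_assoc)
  have "\<exists>\<^sub>F k in sequentially. p (r k) = n (r k) \<or> i (p (r k)) = j"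
    using Qp by (intro eventually_frequently always_eventually) (auto simp: Q_def)
  then consider "\<exists>\<^sub>F k in sequentially. p (r k) = n (r k)" | "\<exists>\<^sub>F k in sequentially. i (p (r k)) = j"
    by (auto simp: frequently_disj_iff)
  then have "v \<noteq> w'"
  proof cases
    case 1
    have "v = w"
      by (rule weakly_tendsto_eq_if_frequently_eq[OF v' wn']) (rule frequently_elim1[OF 1], simp)
    with \<open>w \<noteq> w'\<close> show ?thesis
      by simp
  next
    case 2
    have "j \<in> J v"
      using hit[OF interlacedD(2)[OF il] v'] 2 by simp
    with j show ?thesis
      by blast
  qed
  have "i l \<in> T - {j}" if "p k < l" "l < m k" for k l
    using that T[of k l] np[of k] after[of k l] by (auto simp: Q_def)
  then have "\<forall>k. \<forall>l\<in>{(p \<circ> r) k<..<(m \<circ> r) k}. i l \<in> T - {j}"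
    by (metis comp_apply greaterThanLessThan_iff)
  with il wm' v' \<open>v \<noteq> w'\<close> have "oscillates x i (T - {j}) (p \<circ> r) (m \<circ> r) v w'"
    unfolding oscillates_def by blast
  then show ?thesis
    by blast
qed

text \<open>An oscillation with a minimal set of labels uses only labels common to both limits.\<close>

lemma oscillates_within_common_labels:
  fixes x :: "nat \<Rightarrow> 'a::{real_inner, complete_space}" and i :: "nat \<Rightarrow> 'b"
  assumes bdd: "bounded (range x)"
    and hit: "\<And>p w j. strict_mono p \<Longrightarrow> weakly_tendsto (x \<circ> p) w \<Longrightarrow>
      \<exists>\<^sub>F k in sequentially. i (p k) = j \<Longrightarrow> j \<in> J w"
    and "finite T" "oscillates x i T n m w w'"
  shows "\<exists>n m w w'. oscillates x i (J w \<inter> J w') n m w w'"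
  using assms(3,4)
proof (induction T arbitrary: n m w w' rule: finite_psubset_induct)
  case (psubset T)
  show ?case
  proof (cases "T \<subseteq> J w \<inter> J w'")
    case True
    with psubset.prems have "oscillates x i (J w \<inter> J w') n m w w'"
      by (auto simp: oscillates_def)
    then show ?thesis
      by blast
  next
    case False
    then obtain j where "j \<in> T" and j: "j \<notin> J w \<or> j \<notin> J w'"
      by blast
    have "\<exists>n m w w'. oscillates x i (T - {j}) n m w w'"
      using j
    proof
      assume "j \<notin> J w"
      with bdd hit psubset.prems show ?thesis
        by (rule oscillates_drop_left_label)
    next
      assume "j \<notin> J w'"
      with bdd hit psubset.prems show ?thesis
        by (rule oscillates_drop_right_label)
    qed
    moreover have "T - {j} \<subset> T"
      using \<open>j \<in> T\<close> by blast
    ultimately show ?thesis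
      using psubset.IH by blast
  qed
qed

section \<open>A single greedy step\<close>

lemma inner_greedy_selection_ge:
  assumes "greedy_selection D \<gamma>" "h \<in> D"
  shows "y \<bullet> h \<le> y \<bullet> \<gamma> y"
proof -
  have "ereal (y \<bullet> h) \<le> dict_sup D y"
    unfolding dict_sup_def using assms(2) by (rule SUP_upper)
  moreover have "dict_sup D y \<le> ereal (y \<bullet> \<gamma> y)"
    using assms(1) by (cases "dict_sup D y > 0") (auto simp: greedy_selection_def zero_ereal_def not_less)
  ultimately show ?thesis
    using order_trans ereal_less_eq(3) by blast
qed

lemma inner_greedy_selection_nonneg:
  assumes "greedy_selection D \<gamma>"
  shows "0 \<le> y \<bullet> \<gamma> y"
proof (cases "dict_sup D y > 0")
  case True
  with assms have "ereal (y \<bullet> \<gamma> y) > 0"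
    by (simp add: greedy_selection_def)
  then show ?thesis
    by simp
next
  case False
  with assms show ?thesis
    by (simp add: greedy_selection_def)
qed

lemma norm_greedy_step:
  assumes "greedy_selection D \<gamma>" "D \<subseteq> sphere 0 1"
  shows "(norm (greedy_step \<gamma> y))\<^sup>2 = (norm y)\<^sup>2 - (y \<bullet> \<gamma> y)\<^sup>2"
    and "norm (greedy_step \<gamma> y - y) = y \<bullet> \<gamma> y"
proof -
  have "\<gamma> y = 0 \<or> norm (\<gamma> y) = 1"
    using assms unfolding greedy_selection_def by (metis in_mono mem_sphere_0)
  then have \<gamma>: "y \<bullet> \<gamma> y = 0 \<or> \<gamma> y \<bullet> \<gamma> y = 1" "y \<bullet> \<gamma> y = 0 \<or> norm (\<gamma> y) = 1"
    by (auto simp: norm_eq_1)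
  from \<gamma>(1) show "(norm (greedy_step \<gamma> y))\<^sup>2 = (norm y)\<^sup>2 - (y \<bullet> \<gamma> y)\<^sup>2"
    unfolding greedy_step_def power2_norm_eq_inner
    by (auto simp: inner_diff_left inner_diff_right inner_commute power2_eq_square)
  from \<gamma>(2) show "norm (greedy_step \<gamma> y - y) = y \<bullet> \<gamma> y"
    using inner_greedy_selection_nonneg[OF assms(1), of y] by (auto simp: greedy_step_def)
qed

lemma inner_greedy_step_ge:
  assumes sel: "greedy_selection D \<gamma>" and a: "a \<in> dict_cone D"
  shows "y \<bullet> a \<le> greedy_step \<gamma> y \<bullet> a"
proof -
  have "\<gamma> y \<bullet> a \<le> 0"
    using assms by (cases "dict_sup D y > 0") (auto simp: greedy_selection_def dict_cone_def inner_commute)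
  then have "(y \<bullet> \<gamma> y) * (\<gamma> y \<bullet> a) \<le> 0"
    using inner_greedy_selection_nonneg[OF sel] by (simp add: mult_nonneg_nonpos)
  then show ?thesis
    by (simp add: greedy_step_def inner_diff_left)
qed

section \<open>Weak limits of the greedy orbit\<close>

locale greedy_process =
  fixes D :: "nat \<Rightarrow> 'a::{real_inner, complete_space} set"
    and K :: nat
    and g :: "nat \<Rightarrow> 'a \<Rightarrow> 'a"
    and i :: "nat \<Rightarrow> nat"
    and x :: "nat \<Rightarrow> 'a"
  assumes dict_unit: "j \<in> {1..K} \<Longrightarrow> D j \<subseteq> sphere 0 1"
    and selection: "j \<in> {1..K} \<Longrightarrow> greedy_selection (D j) (g j)"
    and index: "n \<ge> 1 \<Longrightarrow> i n \<in> {1..K}"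
    and step: "n \<ge> 1 \<Longrightarrow> x n = greedy_step (g (i n)) (x (n - 1))"
begin

lemma norm_step:
  "(norm (x (Suc n)))\<^sup>2 = (norm (x n))\<^sup>2 - (norm (x (Suc n) - x n))\<^sup>2"
proof -
  have eq: "x (Suc n) = greedy_step (g (i (Suc n))) (x n)"
    using step[of "Suc n"] by simp
  have "i (Suc n) \<in> {1..K}"
    by (rule index) simp
  then show ?thesis
    unfolding eq by (simp only: norm_greedy_step[OF selection dict_unit])
qed

lemma bounded_orbit: "bounded (range x)"
proof -
  have "norm (x (Suc n)) \<le> norm (x n)" for n
  proof (rule power2_le_imp_le)
    show "(norm (x (Suc n)))\<^sup>2 \<le> (norm (x n))\<^sup>2"
      using norm_step[of n] zero_le_power2[of "norm (x (Suc n) - x n)"] by linarith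
  qed simp
  then have "decseq (\<lambda>n. norm (x n))"
    unfolding decseq_Suc_iff by blast
  then have "norm (x n) \<le> norm (x 0)" for n
    by (rule decseqD) simp
  then show ?thesis
    by (auto simp: bounded_iff)
qed

lemma steps_tendsto_0: "(\<lambda>n. norm (x (Suc n) - x n)) \<longlonglongrightarrow> 0"
proof -
  define s where "s n = (norm (x n))\<^sup>2" for n
  have "decseq s"
    unfolding decseq_Suc_iff s_def
  proof
    fix n
    show "(norm (x (Suc n)))\<^sup>2 \<le> (norm (x n))\<^sup>2"
      using norm_step[of n] zero_le_power2[of "norm (x (Suc n) - x n)"] by linarith
  qed
  moreover have "0 \<le> s n" for n
    by (simp add: s_def)
  ultimately obtain L where L: "s \<longlonglongrightarrow> L"
    by (metis decseq_convergent)
  have "(\<lambda>n. s n - s (Suc n)) \<longlonglongrightarrow> L - L"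
    by (intro tendsto_diff L LIMSEQ_Suc)
  moreover have "s n - s (Suc n) = (norm (x (Suc n) - x n))\<^sup>2" for n
    using norm_step[of n] unfolding s_def by linarith
  ultimately have "(\<lambda>n. (norm (x (Suc n) - x n))\<^sup>2) \<longlonglongrightarrow> 0"
    by simp
  from tendsto_real_sqrt[OF this] show ?thesis
    by simp
qed

lemma weakly_tendsto_pred:
  assumes p: "strict_mono p" and w: "weakly_tendsto (x \<circ> p) w"
  shows "weakly_tendsto (\<lambda>k. x (p k - 1)) w"
  unfolding weakly_tendsto_def
proof
  fix y
  have "(\<lambda>k. x k - x (k - 1)) \<longlonglongrightarrow> 0"
    using tendsto_norm_zero_cancel[OF steps_tendsto_0]
    by (subst filterlim_sequentially_Suc[symmetric]) simp
  then have "(\<lambda>k. x (p k) - x (p k - 1)) \<longlonglongrightarrow> 0"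
    using LIMSEQ_subseq_LIMSEQ[OF _ p] by (fastforce simp: o_def)
  from tendsto_inner[OF this tendsto_const]
  have "(\<lambda>k. x (p k) \<bullet> y - (x (p k) - x (p k - 1)) \<bullet> y) \<longlonglongrightarrow> w \<bullet> y - 0 \<bullet> y"
    using w unfolding weakly_tendsto_def o_def by (intro tendsto_diff) auto
  then show "(\<lambda>k. x (p k - 1) \<bullet> y) \<longlonglongrightarrow> w \<bullet> y"
    by (simp add: inner_diff_left)
qed

text \<open>
  At a step with respect to \<open>D j\<close> no element of \<open>D j\<close> has an inner product with the current vector
  above the length of the step. These lengths tend to zero, so a weak limit along infinitely many
  such steps lies in the cone of \<open>D j\<close>.
\<close>

lemma frequent_index_in_max_index_set:
  assumes p: "strict_mono p" and w: "weakly_tendsto (x \<circ> p) w"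
    and freq: "\<exists>\<^sub>F k in sequentially. i (p k) = j"
  shows "j \<in> max_index_set K D w"
proof -
  have "\<forall>\<^sub>F k in sequentially. 1 \<le> p k"
    using eventually_ge_at_top[of 1]
  proof eventually_elim
    case (elim k)
    then show ?case
      using seq_suble[OF p, of k] by linarith
  qed
  with freq have freq': "\<exists>\<^sub>F k in sequentially. i (p k) = j \<and> 1 \<le> p k"
    by (rule frequently_eventually_frequently)
  then have j: "j \<in> {1..K}"
    using index by (auto dest!: frequently_ex)
  have "w \<bullet> h \<le> 0" if h: "h \<in> D j" for h
  proof (rule ccontr)
    assume pos: "\<not> w \<bullet> h \<le> 0"
    define c where "c k = x (k - 1) \<bullet> h - norm (x k - x (k - 1))" for k
    have "(\<lambda>k. norm (x k - x (k - 1))) \<longlonglongrightarrow> 0"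
      using steps_tendsto_0 by (subst filterlim_sequentially_Suc[symmetric]) simp
    from LIMSEQ_subseq_LIMSEQ[OF this p]
    have "(\<lambda>k. c (p k)) \<longlonglongrightarrow> w \<bullet> h - 0"
      unfolding c_def using weakly_tendsto_pred[OF p w]
      by (intro tendsto_diff) (auto simp: weakly_tendsto_def o_def)
    then have "\<forall>\<^sub>F k in sequentially. 0 < c (p k)"
      using pos by (intro order_tendstoD(1)) auto
    with freq' have "\<exists>\<^sub>F k in sequentially. (i (p k) = j \<and> 1 \<le> p k) \<and> 0 < c (p k)"
      by (rule frequently_eventually_frequently)
    then obtain k where k: "i (p k) = j" "1 \<le> p k" "0 < c (p k)"
      by (auto dest!: frequently_ex)
    have "x (p k - 1) \<bullet> h \<le> norm (x (p k) - x (p k - 1))"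
      using inner_greedy_selection_ge[OF selection[OF j] h]
        norm_greedy_step(2)[OF selection[OF j] dict_unit[OF j]] step[OF k(2)] k(1) by simp
    with k(3) show False
      by (simp add: c_def)
  qed
  with j show ?thesis
    by (simp add: max_index_set_def dict_cone_def)
qed

text \<open>
  A greedy step subtracts a nonnegative multiple of an element of its dictionary, and such an element
  has nonpositive inner product with every vector of the polar cone.
\<close>

lemma inner_mono_between:
  assumes a: "a \<in> cone_Inter D J" and "n \<le> m" and J: "\<And>l. n < l \<Longrightarrow> l \<le> m \<Longrightarrow> i l \<in> J"
  shows "x n \<bullet> a \<le> x m \<bullet> a"
  using \<open>n \<le> m\<close> J
proof (induction m rule: dec_induct)
  case (step m)
  have "i (Suc m) \<in> J"
    using step by simp
  then have "a \<in> dict_cone (D (i (Suc m)))"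
    using a by (simp add: cone_Inter_def)
  then have "x m \<bullet> a \<le> x (Suc m) \<bullet> a"
    using inner_greedy_step_ge[OF selection[OF index]] greedy_process.step[OF greedy_process_axioms, of "Suc m"]
    by fastforce
  with step show ?case
    by fastforce
qed simp

lemma oscillates_inner_mono:
  assumes osc: "oscillates x i J n m w w'" and a: "a \<in> cone_Inter D J"
  shows "(w' - w) \<bullet> a \<ge> 0"
proof -
  have nm: "interlaced n m" and wn: "weakly_tendsto (x \<circ> n) w" and wm: "weakly_tendsto (x \<circ> m) w'"
    and J: "\<And>k l. n k < l \<Longrightarrow> l < m k \<Longrightarrow> i l \<in> J"
    using osc by (auto simp: oscillates_def)
  \<comment> \<open>The step leading to time \<open>m k\<close> need not use a label in \<open>J\<close>; it is left out, at no cost in the limit.\<close>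
  have "x (n k) \<bullet> a \<le> x (m k - 1) \<bullet> a" for k
    using interlacedD(1)[OF nm, of k] by (intro inner_mono_between[OF a]) (auto intro!: J)
  moreover have "(\<lambda>k. x (n k) \<bullet> a) \<longlonglongrightarrow> w \<bullet> a"
    using wn by (simp add: weakly_tendsto_def)
  moreover have "(\<lambda>k. x (m k - 1) \<bullet> a) \<longlonglongrightarrow> w' \<bullet> a"
    using weakly_tendsto_pred[OF interlacedD(3)[OF nm] wm] by (simp add: weakly_tendsto_def)
  ultimately have "w \<bullet> a \<le> w' \<bullet> a"
    by (intro LIMSEQ_le) auto
  then show ?thesis
    by (simp add: inner_diff_left)
qed

text \<open>
  A nonzero weak limit lies outside the cone of some \<open>D j\<close>, whereas the weak limits along the
  infinitely many times with label \<open>j\<close> lie inside it.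
\<close>

lemma ex_oscillation:
  assumes half_space: "not_in_half_space (\<Union>j\<in>{1..K}. D j)"
    and inf: "\<And>j. j \<in> {1..K} \<Longrightarrow> infinite {n. n \<ge> 1 \<and> i n = j}"
    and nontrivial: "partial_weak_limits x \<noteq> {0}"
  shows "\<exists>n m w w'. oscillates x i {1..K} n m w w'"
proof -
  obtain r0 w0 where "strict_mono r0" "weakly_tendsto (x \<circ> r0) w0"
    using bounded_imp_weakly_convergent_subseq[OF bounded_orbit] .
  then have "partial_weak_limits x \<noteq> {}"
    by (auto simp: partial_weak_limits_def)
  with nontrivial obtain w where "w \<in> partial_weak_limits x" "w \<noteq> 0"
    by blast
  then obtain r where r: "strict_mono r" and w: "weakly_tendsto (x \<circ> r) w"
    by (auto simp: partial_weak_limits_def)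
  obtain j h where j: "j \<in> {1..K}" and h: "h \<in> D j" "w \<bullet> h > 0"
    using half_space \<open>w \<noteq> 0\<close> unfolding not_in_half_space_def by fastforce
  obtain s :: "nat \<Rightarrow> nat" where s: "strict_mono s" and is_j: "\<forall>k. s k \<in> {n. n \<ge> 1 \<and> i n = j}"
    using infinite_enumerate[OF inf[OF j]] by blast
  have "bounded (range (x \<circ> s))"
    using bounded_orbit by (rule bounded_subset) auto
  then obtain t w' where t: "strict_mono t" and w': "weakly_tendsto (x \<circ> s \<circ> t) w'"
    by (rule bounded_imp_weakly_convergent_subseq)
  have st: "strict_mono (s \<circ> t)"
    using s t by (rule strict_mono_o)
  have "j \<in> max_index_set K D w'"
    using frequent_index_in_max_index_set[OF st, of w' j] w' is_j by (simp add: o_assoc)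
  then have "w \<noteq> w'"
    using h by (force simp: max_index_set_def dict_cone_def)
  obtain a b where a: "strict_mono a" and b: "strict_mono b" and il: "interlaced (r \<circ> a) (s \<circ> t \<circ> b)"
    using strict_mono_imp_interlaced_subseqs[OF r st] .
  have "weakly_tendsto (x \<circ> (r \<circ> a)) w" "weakly_tendsto (x \<circ> (s \<circ> t \<circ> b)) w'"
    using weakly_tendsto_subseq[OF w a] weakly_tendsto_subseq[OF w' b] by (simp_all add: o_assoc)
  with il \<open>w \<noteq> w'\<close> index have "oscillates x i {1..K} (r \<circ> a) (s \<circ> t \<circ> b) w w'"
    by (simp add: oscillates_def)
  then show ?thesis
    by blast
qed

end

theorem theorem4:
  fixes D :: "nat \<Rightarrow> 'a::{real_inner, complete_space} set"
    and K :: nat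
    and g :: "nat \<Rightarrow> 'a \<Rightarrow> 'a"
    and i :: "nat \<Rightarrow> nat"
    and x :: "nat \<Rightarrow> 'a"
  assumes "K \<ge> 2"
    and "\<And>j. j \<in> {1..K} \<Longrightarrow> D j \<subseteq> sphere 0 1"
    and "not_in_half_space (\<Union>j\<in>{1..K}. D j)"
    and "\<And>j. j \<in> {1..K} \<Longrightarrow> sup_attained (D j)"
    and "\<And>j. j \<in> {1..K} \<Longrightarrow> greedy_selection (D j) (g j)"
    and "\<And>n. n \<ge> 1 \<Longrightarrow> i n \<in> {1..K}"
    and "\<And>k. k \<in> {1..K} \<Longrightarrow> infinite {n. n \<ge> 1 \<and> i n = k}"
    and "\<And>n. n \<ge> 1 \<Longrightarrow> i n \<noteq> i (n + 1)"
    and "\<And>n. n \<ge> 1 \<Longrightarrow> x n = greedy_step (g (i n)) (x (n - 1))"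
    and "partial_weak_limits x \<noteq> {0}"
  shows "\<exists>w\<in>partial_weak_limits x. \<exists>w'\<in>partial_weak_limits x. w \<noteq> w' \<and>
    (\<exists>n m :: nat \<Rightarrow> nat.
      (\<forall>k. n k < m k \<and> m k < n (k + 1)) \<and>
      weakly_tendsto (\<lambda>k. x (n k)) w \<and>
      weakly_tendsto (\<lambda>k. x (m k)) w' \<and>
      (\<forall>l \<in> (\<Union>k. {n k<..<m k}). i l \<in> max_index_set K D w \<inter> max_index_set K D w')) \<and>
    (\<forall>a \<in> cone_Inter D (max_index_set K D w). (w' - w) \<bullet> a \<ge> 0) \<and>
    (\<forall>b \<in> cone_Inter D (max_index_set K D w'). (w' - w) \<bullet> b \<ge> 0)"
proof -
  interpret greedy_process D K g i x
    by unfold_locales (fact assms)+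
  let ?J = "max_index_set K D"
  obtain n m w w' where "oscillates x i {1..K} n m w w'"
    using ex_oscillation[OF assms(3,7,10)] by blast
  with bounded_orbit frequent_index_in_max_index_set finite_atLeastAtMost
  have "\<exists>n m w w'. oscillates x i (?J w \<inter> ?J w') n m w w'"
    by (rule oscillates_within_common_labels)
  then obtain n m w w' where osc: "oscillates x i (?J w \<inter> ?J w') n m w w'"
    by blast
  then have nm: "interlaced n m" and wn: "weakly_tendsto (x \<circ> n) w"
    and wm: "weakly_tendsto (x \<circ> m) w'" and "w \<noteq> w'"
    and labels: "\<forall>l \<in> (\<Union>k. {n k<..<m k}). i l \<in> ?J w \<inter> ?J w'"
    by (auto simp: oscillates_def)
  have W: "w \<in> partial_weak_limits x" "w' \<in> partial_weak_limits x"
    using wn wm interlacedD(2,3)[OF nm] by (auto simp: partial_weak_limits_def)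
  have order: "\<forall>k. n k < m k \<and> m k < n (k + 1)"
    using nm by (simp add: interlaced_def)
  have limits: "weakly_tendsto (\<lambda>k. x (n k)) w" "weakly_tendsto (\<lambda>k. x (m k)) w'"
    using wn wm by (simp_all add: o_def)
  have "(w' - w) \<bullet> a \<ge> 0" if "a \<in> cone_Inter D (?J w) \<union> cone_Inter D (?J w')" for a
    using oscillates_inner_mono[OF osc] that by (auto simp: cone_Inter_def)
  then have cones: "\<forall>a \<in> cone_Inter D (?J w). (w' - w) \<bullet> a \<ge> 0"
    "\<forall>b \<in> cone_Inter D (?J w'). (w' - w) \<bullet> b \<ge> 0"
    by blast+
  show ?thesis
    by (rule bexI[OF _ W(1)], rule bexI[OF _ W(2)], intro conjI exI[of _ n] exI[of _ m])
      (fact \<open>w \<noteq> w'\<close> order limits labels cones)+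
qed

end
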